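(* There exists no sentence $\sigma$ of first-order logic over the vocabulary $\{D\}$ ($D$ a ternary relation symbol) such that, for every connected ternary structure $(X,D)$, $(X,D)$ is a $W$-structure if and only if $(X,D)$ satisfies $\sigma$.
   Context: A ternary structure is a pair $(X,D)$ with $X$ a finite nonempty set and $D\subseteq X^3$. Its underlying graph has vertex set $X$, distinct $u,v$ being adjacent iff $\{x\in X: D(u,x,v)\}\cup\{x\in X:D(v,x,u)\}=\{u,v\}$; the structure is connected if its underlying graph is connected. In a finite simple graph $G$, a walk $W=w_1w_2\cdots w_k$ ($k\ge 2$) is a toll walk if $w_1\neq w_k$, $w_2$ is the only neighbor of $w_1$ among the vertices of $W$, and $w_{k-1}$ is the only neighbor of $w_k$ among the vertices of $W$. The toll walk transit function $T$ of $G$ is given by $T(u,u)=\{u\}$ and, for $u\ne v$, $T(u,v)$ is the set of all vertices lying on some toll walk from $u$ to $v$. The $W$-structure of a graph $G$ is $(V(G),D)$ with $D(x,y,z)$ iff $y\in T(x,z)$; a ternary structure is a $W$-structure if it is the $W$-structure of some (finite, simple) graph. *)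

theory Defs
  imports "Graph_Theory.Graph_Theory"
begin

section \<open>Ternary structures\<close>

definition ternary_structure :: "'a set \<Rightarrow> ('a \<times> 'a \<times> 'a) set \<Rightarrow> bool" where
  "ternary_structure X D \<longleftrightarrow> finite X \<and> X \<noteq> {} \<and> D \<subseteq> X \<times> X \<times> X"

definition underlying_graph :: "'a set \<Rightarrow> ('a \<times> 'a \<times> 'a) set \<Rightarrow> 'a pair_pre_digraph" where
  "underlying_graph X D =
    \<lparr> pverts = X,
      parcs = {(u, v). u \<in> X \<and> v \<in> X \<and> u \<noteq> v \<and>
                 {x \<in> X. (u, x, v) \<in> D} \<union> {x \<in> X. (v, x, u) \<in> D} = {u, v}} \<rparr>"

definition connected_structure :: "'a set \<Rightarrow> ('a \<times> 'a \<times> 'a) set \<Rightarrow> bool" where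
  "connected_structure X D \<longleftrightarrow>
     ternary_structure X D \<and> Digraph_Component.connected (with_proj (underlying_graph X D))"


section \<open>Toll walks and W-structures\<close>

text \<open>
  Finite simple graphs are the library's \<^locale>\<open>pair_graph\<close>: a finite vertex set with a symmetric
  and irreflexive set of arcs. A walk \<open>w\<^sub>1 \<dots> w\<^sub>k\<close> is a list, so \<open>w\<^sub>2\<close> is \<open>w ! 1\<close> and
  \<open>w\<^sub>k\<^sub>-\<^sub>1\<close> is \<open>w ! (length w - 2)\<close>.
\<close>

definition toll_walk :: "'a pair_pre_digraph \<Rightarrow> 'a vwalk \<Rightarrow> bool" where
  "toll_walk G w \<longleftrightarrow>
     vwalk w (with_proj G) \<and> length w \<ge> 2 \<and> hd w \<noteq> last w \<and>
     {x \<in> set w. (hd w, x) \<in> parcs G} = {w ! 1} \<and>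
     {x \<in> set w. (last w, x) \<in> parcs G} = {w ! (length w - 2)}"

definition toll_transit :: "'a pair_pre_digraph \<Rightarrow> 'a \<Rightarrow> 'a \<Rightarrow> 'a set" where
  "toll_transit G u v =
     (if u = v then {u}
      else {x. \<exists>w. toll_walk G w \<and> hd w = u \<and> last w = v \<and> x \<in> set w})"

definition W_structure_of :: "'a pair_pre_digraph \<Rightarrow> ('a \<times> 'a \<times> 'a) set" where
  "W_structure_of G =
     {(x, y, z). x \<in> pverts G \<and> y \<in> pverts G \<and> z \<in> pverts G \<and> y \<in> toll_transit G x z}"

definition W_structure :: "'a set \<Rightarrow> ('a \<times> 'a \<times> 'a) set \<Rightarrow> bool" where
  "W_structure X D \<longleftrightarrow> (\<exists>G. pair_graph G \<and> pverts G = X \<and> D = W_structure_of G)"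


section \<open>First-order logic with equality over one ternary relation symbol\<close>

text \<open>Variables are named by natural numbers; the remaining connectives and the universal
  quantifier are definable from these.\<close>

datatype fo_formula =
    FO_Eq nat nat
  | FO_D nat nat nat
  | FO_Neg fo_formula
  | FO_And fo_formula fo_formula
  | FO_Ex nat fo_formula

primrec fo_free_vars :: "fo_formula \<Rightarrow> nat set" where
  "fo_free_vars (FO_Eq i j) = {i, j}"
| "fo_free_vars (FO_D i j k) = {i, j, k}"
| "fo_free_vars (FO_Neg \<phi>) = fo_free_vars \<phi>"
| "fo_free_vars (FO_And \<phi> \<psi>) = fo_free_vars \<phi> \<union> fo_free_vars \<psi>"
| "fo_free_vars (FO_Ex i \<phi>) = fo_free_vars \<phi> - {i}"

definition fo_sentence :: "fo_formula \<Rightarrow> bool" where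
  "fo_sentence \<phi> \<longleftrightarrow> fo_free_vars \<phi> = {}"

primrec fo_sat ::
  "'a set \<Rightarrow> ('a \<times> 'a \<times> 'a) set \<Rightarrow> (nat \<Rightarrow> 'a) \<Rightarrow> fo_formula \<Rightarrow> bool" where
  "fo_sat X D e (FO_Eq i j) \<longleftrightarrow> e i = e j"
| "fo_sat X D e (FO_D i j k) \<longleftrightarrow> (e i, e j, e k) \<in> D"
| "fo_sat X D e (FO_Neg \<phi>) \<longleftrightarrow> \<not> fo_sat X D e \<phi>"
| "fo_sat X D e (FO_And \<phi> \<psi>) \<longleftrightarrow> fo_sat X D e \<phi> \<and> fo_sat X D e \<psi>"
| "fo_sat X D e (FO_Ex i \<phi>) \<longleftrightarrow> (\<exists>a\<in>X. fo_sat X D (e(i := a)) \<phi>)"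

text \<open>For a sentence the truth value does not depend on the assignment, and assignments into
  the nonempty universe exist, so the quantifier over assignments is harmless.\<close>

definition fo_models :: "'a set \<Rightarrow> ('a \<times> 'a \<times> 'a) set \<Rightarrow> fo_formula \<Rightarrow> bool" where
  "fo_models X D \<sigma> \<longleftrightarrow> (\<forall>e. range e \<subseteq> X \<longrightarrow> fo_sat X D e \<sigma>)"

text \<open>
  Sentences do not mention the type of the universe. HOL cannot quantify over types inside a
  formula, so the non-definability claim is made for structures whose universe is a set of natural
  numbers. This loses nothing: a sentence that characterised the W-structures among all connected
  ternary structures would in particular do so among these.
\<close>

end

theory Submission
  imports Defs
begin

text \<open>
  The graph of a W-structure is its underlying graph, so a structure is a W-structure iff its
  relation is the toll walk relation of its own underlying graph. Join a hub to every vertex of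
  \<open>C\<^sub>2\<^sub>m\<close>, respectively of two disjoint copies of \<open>C\<^sub>m\<close>, and let \<open>D\<close> be as large as possible:
  \<open>D(u, x, v)\<close> fails only if \<open>u = v \<noteq> x\<close>, or if \<open>u\<close>, \<open>v\<close> are adjacent and \<open>x\<close> is neither of them.
  For the first graph this is the toll walk relation, since two nonadjacent rim vertices are joined
  by two induced arcs covering the rim. For the second it is not, since a toll walk between
  different rims cannot use a rim neighbour of its first vertex. As \<open>D\<close> is quantifier-free
  definable from adjacency, the Ehrenfeucht-Fraisse argument for long cycles shows that no sentence
  distinguishes the two structures for all \<open>m\<close>.
\<close>

section \<open>Toll walks in a finite simple graph\<close>

text \<open>Closure of \<open>C\<close> is demanded only for steps to vertices of \<open>w\<close>,
  since the toll conditions restrict neighbours only within the walk.\<close>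

lemma vwalk_closed_set:
  assumes "vwalk w (with_proj G)" and "hd w \<in> C"
    and "\<And>x y. x \<in> C \<Longrightarrow> y \<in> set w \<Longrightarrow> (x, y) \<in> parcs G \<Longrightarrow> y \<in> C"
  shows "set w \<subseteq> C"
  using assms
proof (induction w rule: vwalk_arcs.induct)
  case (3 x y w)
  have "y \<in> C" using "3.prems" by (auto simp: vwalk_def)
  moreover have "vwalk (y # w) (with_proj G)" using "3.prems"(1) by (auto simp: vwalk_def)
  ultimately have "set (y # w) \<subseteq> C" using "3.IH" "3.prems"(3) by auto
  then show ?case using "3.prems"(2) by auto
qed (auto simp: vwalk_def)

lemma vwalk_nth:
  assumes "w \<noteq> []" and "set w \<subseteq> pverts G"
    and "\<And>k. Suc k < length w \<Longrightarrow> (w ! k, w ! Suc k) \<in> parcs G"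
  shows "vwalk w (with_proj G)"
  using assms
proof (induction w rule: vwalk_arcs.induct)
  case (3 x y w)
  have "vwalk (y # w) (with_proj G)"
  proof (rule "3.IH")
    show "((y # w) ! k, (y # w) ! Suc k) \<in> parcs G" if "Suc k < length (y # w)" for k
      using "3.prems"(3)[of "Suc k"] that by simp
  qed (use "3.prems" in auto)
  then show ?case using "3.prems"(2) "3.prems"(3)[of 0] by (auto simp: vwalk_def)
qed (auto simp: vwalk_def)

context pair_graph
begin

lemma parcs_sym: "(u, v) \<in> parcs G \<Longrightarrow> (v, u) \<in> parcs G"
  using pair_sym_arcs by (auto simp: symmetric_conv)

lemma parcs_irrefl: "(u, u) \<notin> parcs G"
  using pair_no_loops by fastforce

text \<open>Each end lies on the walk and is adjacent to the other, so it is the other's only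
  neighbour there; the walk can never leave \<open>{u, v}\<close>.\<close>

lemma toll_transit_adjacent:
  assumes "(u, v) \<in> parcs G"
  shows "toll_transit G u v = {u, v}"
proof -
  have "u \<noteq> v" using assms parcs_irrefl by auto
  have "toll_walk G [u, v]"
    using assms \<open>u \<noteq> v\<close> parcs_irrefl parcs_sym[OF assms] in_arcsD1 in_arcsD2
    by (auto simp: toll_walk_def vwalk_def)
  then have "{u, v} \<subseteq> toll_transit G u v"
    using \<open>u \<noteq> v\<close> unfolding toll_transit_def by force
  moreover have "set w \<subseteq> {u, v}" if w: "toll_walk G w" "hd w = u" "last w = v" for w
  proof (rule vwalk_closed_set)
    show "vwalk w (with_proj G)" "hd w \<in> {u, v}" using w by (auto simp: toll_walk_def)
    have "u \<in> set w" "v \<in> set w"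
      using w by (auto simp: toll_walk_def vwalk_def)
    then have "v \<in> {x \<in> set w. (u, x) \<in> parcs G}" "u \<in> {x \<in> set w. (v, x) \<in> parcs G}"
      using assms parcs_sym[OF assms] by simp_all
    moreover have "{x \<in> set w. (u, x) \<in> parcs G} = {w ! 1}"
      "{x \<in> set w. (v, x) \<in> parcs G} = {w ! (length w - 2)}"
      using w by (simp_all add: toll_walk_def)
    ultimately have "{x \<in> set w. (u, x) \<in> parcs G} = {v}" "{x \<in> set w. (v, x) \<in> parcs G} = {u}"
      by (metis singletonD)+
    then show "y \<in> {u, v}" if "x \<in> {u, v}" "y \<in> set w" "(x, y) \<in> parcs G" for x y
      using that by blast
  qed
  ultimately show ?thesis using \<open>u \<noteq> v\<close> by (auto simp: toll_transit_def)
qed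

lemma adjacent_if_toll_walk_subset:
  assumes "toll_walk G w" and "set w \<subseteq> {u, v}" and "hd w = u"
  shows "(u, v) \<in> parcs G"
proof -
  have "w ! 1 \<in> set w" "(u, w ! 1) \<in> parcs G"
    using assms by (auto simp: toll_walk_def)
  then show ?thesis using assms(2) parcs_irrefl by auto
qed

lemma underlying_graph_eqI:
  assumes "\<And>u v. u \<in> pverts G \<Longrightarrow> v \<in> pverts G \<Longrightarrow> u \<noteq> v \<Longrightarrow>
    {x \<in> pverts G. (u, x, v) \<in> D} \<union> {x \<in> pverts G. (v, x, u) \<in> D} = {u, v} \<longleftrightarrow> (u, v) \<in> parcs G"
  shows "underlying_graph (pverts G) D = G"
proof -
  have "(u, v) \<in> parcs (underlying_graph (pverts G) D) \<longleftrightarrow> (u, v) \<in> parcs G" for u v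
    using assms[of u v] parcs_irrefl[of u] in_arcsD1[of u v] in_arcsD2[of u v]
    by (simp only: underlying_graph_def pair_pre_digraph.simps mem_Collect_eq prod.case) blast
  then show ?thesis
    by (intro pair_pre_digraph.equality) (auto simp: underlying_graph_def)
qed

text \<open>Adjacent vertices have transit set \<open>{u, v}\<close>; conversely, a toll walk
  confined to \<open>{u, v}\<close> must step along the arc itself. Hence a graph is determined by
  its W-structure.\<close>

lemma underlying_graph_W_structure_of:
  "underlying_graph (pverts G) (W_structure_of G) = G"
proof -
  have "{x \<in> pverts G. (u, x, v) \<in> W_structure_of G} \<union> {x \<in> pverts G. (v, x, u) \<in> W_structure_of G}
        = {u, v} \<longleftrightarrow> (u, v) \<in> parcs G"
    if uv: "u \<in> pverts G" "v \<in> pverts G" "u \<noteq> v" for u v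
  proof -
    have T: "{x \<in> pverts G. (u, x, v) \<in> W_structure_of G} = toll_transit G u v"
      if "u \<in> pverts G" "v \<in> pverts G" for u v
      using that by (auto simp: W_structure_of_def toll_transit_def toll_walk_def vwalk_def)
    \<comment> \<open>Nonemptiness is a separate assumption because vertices in different components
      are joined by no toll walk.\<close>
    have adj: "(u, v) \<in> parcs G"
      if sub: "toll_transit G u v \<subseteq> {u, v}" and ne: "toll_transit G u v \<noteq> {}" and "u \<noteq> v" for u v
    proof -
      obtain w where "toll_walk G w" "hd w = u" "last w = v"
        using ne \<open>u \<noteq> v\<close> by (auto simp: toll_transit_def)
      moreover from this have "set w \<subseteq> {u, v}"
        using sub \<open>u \<noteq> v\<close> by (fastforce simp: toll_transit_def)
      ultimately show ?thesis using adjacent_if_toll_walk_subset by blast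
    qed
    show ?thesis
    proof
      assume "{x \<in> pverts G. (u, x, v) \<in> W_structure_of G}
                \<union> {x \<in> pverts G. (v, x, u) \<in> W_structure_of G} = {u, v}"
      then have "toll_transit G u v \<union> toll_transit G v u = {u, v}" using T uv by simp
      \<comment> \<open>At least one of the two directions is nonempty and contained in
        \<open>{u, v}\<close>; either one yields the arc.\<close>
      then show "(u, v) \<in> parcs G"
        using adj[of u v] adj[of v u] parcs_sym uv by blast
    next
      assume "(u, v) \<in> parcs G"
      then show "{x \<in> pverts G. (u, x, v) \<in> W_structure_of G}
                \<union> {x \<in> pverts G. (v, x, u) \<in> W_structure_of G} = {u, v}"
        using T uv parcs_sym toll_transit_adjacent by auto
    qed
  qed
  then show ?thesis by (rule underlying_graph_eqI)
qed

end


section \<open>Saturated structures\<close>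

definition saturated :: "'a pair_pre_digraph \<Rightarrow> ('a \<times> 'a \<times> 'a) set" where
  "saturated G = {(u, x, v). u \<in> pverts G \<and> x \<in> pverts G \<and> v \<in> pverts G \<and>
     (u = v \<longrightarrow> x = u) \<and> ((u, v) \<in> parcs G \<longrightarrow> x \<in> {u, v})}"

text \<open>A nonadjacent pair receives every vertex, and with more than two vertices this differs
  from \<open>{u, v}\<close>.\<close>

lemma (in pair_graph) underlying_graph_saturated:
  assumes "card (pverts G) > 2"
  shows "underlying_graph (pverts G) (saturated G) = G"
proof -
  have ne: "pverts G \<noteq> {u, v}" for u v
    using assms card_2_iff[of "{u, v}"] by (cases "u = v") auto
  have "{x \<in> pverts G. (u, x, v) \<in> saturated G} \<union> {x \<in> pverts G. (v, x, u) \<in> saturated G} = {u, v}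
        \<longleftrightarrow> (u, v) \<in> parcs G"
    if uv: "u \<in> pverts G" "v \<in> pverts G" "u \<noteq> v" for u v
  proof (cases "(u, v) \<in> parcs G")
    case True
    then show ?thesis using uv parcs_sym[OF True] by (auto simp: saturated_def)
  next
    case False
    then have "{x \<in> pverts G. (u, x, v) \<in> saturated G} = pverts G"
      "{x \<in> pverts G. (v, x, u) \<in> saturated G} = pverts G"
      using uv parcs_sym by (auto simp: saturated_def)
    then show ?thesis using False ne by simp
  qed
  then show ?thesis by (rule underlying_graph_eqI)
qed

text \<open>Any graph realizing the structure equals its underlying graph, which is
  \<open>G\<close>; so only the toll walks of \<open>G\<close> need to be examined.\<close>

lemma (in pair_graph) W_structure_saturated_iff:
  assumes "card (pverts G) > 2"
  shows "W_structure (pverts G) (saturated G) \<longleftrightarrow> saturated G = W_structure_of G"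
proof
  assume "W_structure (pverts G) (saturated G)"
  then obtain H where H: "pair_graph H" "pverts H = pverts G" "saturated G = W_structure_of H"
    by (auto simp: W_structure_def)
  then have "H = G"
    using pair_graph.underlying_graph_W_structure_of[OF H(1)] underlying_graph_saturated[OF assms]
    by simp
  then show "saturated G = W_structure_of G" using H by simp
qed (auto simp: W_structure_def)


section \<open>Wheels with several rims\<close>

text \<open>Rotation by \<open>d\<close> inside each of the blocks \<open>{0..<m}\<close>, \<open>{m..<2 * m}\<close>, \dots\<close>

definition spin :: "nat \<Rightarrow> int \<Rightarrow> nat \<Rightarrow> nat" where
  "spin m d x = x div m * m + nat ((int (x mod m) + d) mod int m)"

section \<open>Rotations as an action of the integers\<close>

lemma spin_mod_less: "m > 0 \<Longrightarrow> nat ((int (x mod m) + d) mod int m) < m"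
  by (simp add: nat_less_iff)

lemma spin_div: "m > 0 \<Longrightarrow> spin m d x div m = x div m"
  using spin_mod_less[of m x d] by (simp add: spin_def)

lemma spin_mod: "m > 0 \<Longrightarrow> spin m d x mod m = nat ((int (x mod m) + d) mod int m)"
  using spin_mod_less[of m x d] by (simp add: spin_def)

lemma spin_spin: "m > 0 \<Longrightarrow> spin m a (spin m b x) = spin m (a + b) x"
  unfolding spin_def[of m a "spin m b x"]
  by (simp add: spin_div spin_mod) (simp add: spin_def mod_simps algebra_simps)

lemma spin_0: "spin m 0 x = x"
  by (cases "m = 0") (simp_all add: spin_def flip: of_nat_mod)

lemma spin_eq_iff:
  assumes "m > 0"
  shows "spin m a x = spin m b x \<longleftrightarrow> int m dvd a - b"
proof -
  have "spin m a x = spin m b x \<longleftrightarrow> (int (x mod m) + a) mod int m = (int (x mod m) + b) mod int m"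
    using assms by (simp add: spin_def nat_eq_iff)
  also have "\<dots> \<longleftrightarrow> int m dvd (int (x mod m) + a) - (int (x mod m) + b)"
    by (rule mod_eq_dvd_iff)
  finally show ?thesis by simp
qed

lemma spin_eq_self_iff:
  "m > 0 \<Longrightarrow> spin m d x = x \<longleftrightarrow> int m dvd d"
  using spin_eq_iff[of m d x 0] by (simp add: spin_0)

lemma spin_eq_spin_iff:
  assumes "m > 0"
  shows "spin m a x = spin m b y \<longleftrightarrow> spin m (a - b) x = y"
proof -
  have "spin m (- b) (spin m b y) = y" "spin m (- b) (spin m a x) = spin m (a - b) x"
    "spin m b (spin m (a - b) x) = spin m a x"
    using assms by (simp_all add: spin_spin spin_0)
  then show ?thesis by metis
qed

text \<open>Divisibility makes \<open>{..<L}\<close> a union of whole blocks, each invariant under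
  rotation.\<close>

lemma spin_less:
  assumes "m dvd L" and "x < L"
  shows "spin m d x < L"
proof -
  obtain q where q: "L = q * m" using assms(1) by (metis dvdE mult.commute)
  then have "m > 0" using assms(2) by (cases m) auto
  then have "spin m d x div m < q"
    using assms(2) q by (simp add: spin_div less_mult_imp_div_less)
  then show ?thesis using q \<open>m > 0\<close> by (simp add: div_less_iff_less_mult)
qed

text \<open>The hub is \<open>L\<close>. When \<open>m dvd L\<close>, the vertices below
  \<open>L\<close> split into \<open>L div m\<close> rims of length \<open>m\<close>, so
  \<open>wheel (2 * m) (2 * m)\<close> and \<open>wheel (2 * m) m\<close> have one and two rims over
  the same vertex set.\<close>

definition wheel :: "nat \<Rightarrow> nat \<Rightarrow> nat pair_pre_digraph" where
  "wheel L m = \<lparr> pverts = {..L},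
     parcs = {(x, y). x < L \<and> y < L \<and> (spin m 1 x = y \<or> spin m (-1) x = y)}
       \<union> {..<L} \<times> {L} \<union> {L} \<times> {..<L} \<rparr>"

lemma pverts_wheel [simp]: "pverts (wheel L m) = {..L}"
  by (simp add: wheel_def)

lemma wheel_rim_arc:
  "x < L \<Longrightarrow> y < L \<Longrightarrow> (x, y) \<in> parcs (wheel L m) \<longleftrightarrow> spin m 1 x = y \<or> spin m (-1) x = y"
  by (auto simp: wheel_def)

lemma wheel_spoke_arc: "x < L \<Longrightarrow> (x, L) \<in> parcs (wheel L m)" "x < L \<Longrightarrow> (L, x) \<in> parcs (wheel L m)"
  by (auto simp: wheel_def)

text \<open>Rotations by 1 and -1 are mutually inverse, which gives symmetry; \<open>m > 1\<close>
  keeps them from fixing a vertex.\<close>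

lemma pair_graph_wheel:
  assumes "m > 1"
  shows "pair_graph (wheel L m)"
proof
  show "finite (parcs (wheel L m))"
    by (rule finite_subset[of _ "{..L} \<times> {..L}"]) (auto simp: wheel_def)
  have "spin m 1 x = y \<longleftrightarrow> spin m (-1) y = x" for x y
    using spin_eq_spin_iff[of m 1 x 0 y] spin_eq_spin_iff[of m 0 x "-1" y] assms
    by (auto simp: spin_0)
  then have "sym (parcs (wheel L m))"
    by (auto simp: sym_def wheel_def)
  then show "symmetric (with_proj (wheel L m))" by (simp add: symmetric_def)
  have "spin m 1 x \<noteq> x" "spin m (-1) x \<noteq> x" for x
    using assms by (simp_all add: spin_eq_self_iff)
  then have "(x, x) \<notin> parcs (wheel L m)" for x by (simp add: wheel_def)
  then show "fst e \<noteq> snd e" if "e \<in> parcs (wheel L m)" for e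
    using that by (metis prod.collapse)
qed (auto simp: wheel_def)

text \<open>Every vertex reaches every other through the hub. \<open>L > 1\<close> supplies the
  three vertices needed to recover the wheel from its saturated structure.\<close>

lemma connected_structure_wheel:
  assumes "m > 1" and "L > 1"
  shows "connected_structure {..L} (saturated (wheel L m))"
proof -
  interpret W: pair_graph "wheel L m" using assms(1) by (rule pair_graph_wheel)
  have U: "underlying_graph {..L} (saturated (wheel L m)) = wheel L m"
    using W.underlying_graph_saturated assms(2) by simp
  have hub: "x \<rightarrow>\<^sup>*\<^bsub>wheel L m\<^esub> L" "L \<rightarrow>\<^sup>*\<^bsub>wheel L m\<^esub> x" if "x \<le> L" for x
    using that wheel_spoke_arc[of x L m] by (cases "x = L"; auto)+
  have "Digraph_Component.connected (with_proj (wheel L m))"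
    unfolding Digraph_Component.connected_def
    using W.reachable_mk_symmetricI[OF W.reachable_trans[OF hub]]
    by (intro strongly_connectedI) auto
  then show ?thesis
    by (simp add: connected_structure_def ternary_structure_def U) (auto simp: saturated_def)
qed

section \<open>Toll walks in a wheel with one rim\<close>

lemma toll_walk_rim:
  assumes u: "u < L" and d: "2 \<le> d" "d + 2 \<le> L" and s: "s = 1 \<or> s = -1"
  shows "toll_walk (wheel L L) (map (\<lambda>k. spin L (s * int k) u) [0..<Suc d])"
    (is "toll_walk _ ?w")
proof -
  let ?p = "\<lambda>k. spin L (s * int k) u"
  have L: "L > 0" using u by simp
  have lt: "?p k < L" for k using u by (simp add: spin_less)
  \<comment> \<open>The walk is an induced path: only consecutive vertices are adjacent, which gives
    the toll conditions at both ends.\<close>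
  have arc: "(?p j, ?p k) \<in> parcs (wheel L L) \<longleftrightarrow> j = Suc k \<or> k = Suc j"
    if jk: "j \<le> d" "k \<le> d" for j k
  proof -
    have eq: "spin L c (?p j) = ?p k \<longleftrightarrow> int L dvd c + s * int j - s * int k" for c
      using L by (simp add: spin_spin spin_eq_iff)
    have "(?p j, ?p k) \<in> parcs (wheel L L) \<longleftrightarrow>
        int L dvd 1 + s * int j - s * int k \<or> int L dvd -1 + s * int j - s * int k"
      using lt by (simp only: wheel_rim_arc eq)
    also have "\<dots> \<longleftrightarrow> int L dvd 1 + int j - int k \<or> int L dvd -1 + int j - int k"
      using s dvd_minus_iff[of "int L" "1 + int j - int k"]
        dvd_minus_iff[of "int L" "-1 + int j - int k"] by (auto simp: algebra_simps)
    \<comment> \<open>From \<open>j, k \<le> d\<close> and \<open>d + 2 \<le> L\<close>, both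
      numbers have absolute value at most \<open>d + 1 < L\<close>, so divisibility by
      \<open>L\<close> forces zero.\<close>
    also have "\<dots> \<longleftrightarrow> 1 + int j - int k = 0 \<or> -1 + int j - int k = 0"
    proof -
      have "int L dvd z \<longleftrightarrow> z = 0" if "\<bar>z\<bar> < int L" for z
        using that dvd_imp_le_int[of z "int L"] by auto
      then show ?thesis using jk d by simp
    qed
    finally show ?thesis by auto
  qed
  have inj: "?p j \<noteq> ?p k" if "j \<le> d" "k \<le> d" "j \<noteq> k" for j k
  proof -
    have "\<not> int L dvd s * int j - s * int k"
      using that d s dvd_imp_le_int[of "s * int j - s * int k" "int L"] by auto
    then show ?thesis using L by (simp add: spin_eq_iff)
  qed
  have set: "set ?w = ?p ` {..d}" by (auto simp del: upt_Suc)
  have hd: "hd ?w = ?p 0" and last: "last ?w = ?p d"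
    by (simp_all add: hd_map last_map del: upt_Suc)
  have nth: "?w ! k = ?p k" if "k \<le> d" for k
    using that nth_map_upt[of k "Suc d" 0 ?p] by simp
  have "vwalk ?w (with_proj (wheel L L))"
  proof (rule vwalk_nth)
    show "set ?w \<subseteq> pverts (wheel L L)" unfolding set using lt by (auto intro: less_imp_le)
    show "(?w ! k, ?w ! Suc k) \<in> parcs (wheel L L)" if "Suc k < length ?w" for k
      using that arc[of k "Suc k"] nth[of k] nth[of "Suc k"] by auto
  qed simp
  moreover
  have nbrs: "{x \<in> ?p ` {..d}. (?p j, x) \<in> parcs (wheel L L)}
      = ?p ` {k. k \<le> d \<and> (j = Suc k \<or> k = Suc j)}" if "j \<le> d" for j
    using arc[OF that] by blast
  have "{k. k \<le> d \<and> (0 = Suc k \<or> k = Suc 0)} = {1}"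
    "{k. k \<le> d \<and> (d = Suc k \<or> k = Suc d)} = {d - 1}"
    using d by auto
  then have "{x \<in> ?p ` {..d}. (?p 0, x) \<in> parcs (wheel L L)} = {?p 1}"
    "{x \<in> ?p ` {..d}. (?p d, x) \<in> parcs (wheel L L)} = {?p (d - 1)}"
    unfolding nbrs[OF le0] nbrs[OF order_refl] by simp_all
  ultimately show ?thesis
    using d inj[of 0 d] nth[of 1] nth[of "d - 1"]
    unfolding toll_walk_def set hd last by simp
qed

lemma spin_hit:
  assumes "x < L" and "u < L"
  obtains k where "k < L" "spin L (int k) u = x"
proof
  show "(x + L - u) mod L < L" using assms by simp
  show "spin L (int ((x + L - u) mod L)) u = x"
    using assms by (simp add: spin_def zmod_int mod_simps)
qed

text \<open>The hub is adjacent to every rim vertex, so \<open>u\<close> and \<open>v\<close> lie on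
  the rim. The walk \<open>[u, L, v]\<close> covers the hub, and the two arcs between
  \<open>u\<close> and \<open>v\<close> cover the rim.\<close>

lemma toll_transit_wheel_nonadjacent:
  assumes "L > 1" and uv: "u \<le> L" "v \<le> L" "u \<noteq> v" "(u, v) \<notin> parcs (wheel L L)"
  shows "toll_transit (wheel L L) u v = {..L}"
proof -
  interpret W: pair_graph "wheel L L" using assms(1) by (rule pair_graph_wheel)
  have lt: "u < L" "v < L" using uv wheel_spoke_arc[of u L L] wheel_spoke_arc[of v L L]
    by (metis le_neq_implies_less)+
  obtain d where d: "d < L" "spin L (int d) u = v" using spin_hit lt by metis
  \<comment> \<open>\<open>u \<noteq> v\<close> excludes \<open>d = 0\<close>, and nonadjacency
    excludes \<open>1\<close> and \<open>L - 1\<close>; so both arcs have length at least 2.\<close>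
  have d2: "2 \<le> d" "d + 2 \<le> L"
  proof -
    have "d \<noteq> 0" using d(2) uv(3) spin_0[of L u] by (metis of_nat_0)
    moreover have "d \<noteq> 1" using d(2) uv(4) wheel_rim_arc[OF lt] by (metis of_nat_1)
    moreover have "d \<noteq> L - 1"
    proof
      assume "d = L - 1"
      then have "spin L (-1) u = v" using d lt spin_eq_iff[of L "-1" u "int d"]
        by simp
      then show False using uv lt by (auto simp: wheel_rim_arc)
    qed
    ultimately show "2 \<le> d" "d + 2 \<le> L" using d by auto
  qed
  have "x \<in> toll_transit (wheel L L) u v" if "x \<le> L" for x
  proof (cases "x = L")
    case True
    have "(v, u) \<notin> parcs (wheel L L)" using uv W.parcs_sym by blast
    then have "toll_walk (wheel L L) [u, L, v]"
      using uv lt wheel_spoke_arc[of u L L] wheel_spoke_arc[of v L L] W.parcs_irrefl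
      by (auto simp: toll_walk_def vwalk_def)
    then show ?thesis using True uv(3) unfolding toll_transit_def by force
  next
    case False
    then have "x < L" using that by simp
    then obtain k where k: "k < L" "spin L (int k) u = x" using spin_hit lt by metis
    \<comment> \<open>If \<open>x\<close> comes after \<open>v\<close> on the forward tour from
      \<open>u\<close>, the backward arc has length \<open>L - d\<close> and meets \<open>x\<close>
      after \<open>L - k\<close> steps.\<close>
    have "\<exists>s d' k'. (s = 1 \<or> s = -1) \<and> 2 \<le> d' \<and> d' + 2 \<le> L \<and> k' \<le> d' \<and>
        spin L (s * int d') u = v \<and> spin L (s * int k') u = x"
    proof (cases "k \<le> d")
      case True
      then show ?thesis using d d2 k by (intro exI[of _ 1] exI[of _ d] exI[of _ k]) auto
    next
      case False
      have "spin L (-1 * int (L - d)) u = v" "spin L (-1 * int (L - k)) u = x"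
        using d k lt spin_eq_iff[of L "- int (L - d)" u "int d"]
          spin_eq_iff[of L "- int (L - k)" u "int k"] by auto
      then show ?thesis using d d2 k False
        by (intro exI[of _ "-1"] exI[of _ "L - d"] exI[of _ "L - k"]) auto
    qed
    then obtain s d' k' where s: "s = 1 \<or> s = -1" "2 \<le> d'" "d' + 2 \<le> L" "k' \<le> d'"
      "spin L (s * int d') u = v" "spin L (s * int k') u = x" by blast
    let ?w = "map (\<lambda>k. spin L (s * int k) u) [0..<Suc d']"
    have "toll_walk (wheel L L) ?w" using toll_walk_rim lt(1) s(1-3) by blast
    moreover have "hd ?w = u" by (simp add: hd_map spin_0 del: upt_Suc)
    moreover have "last ?w = v" using s by (simp add: last_map)
    moreover have "x \<in> set ?w" unfolding set_map set_upt
      using s(4,6) by (intro image_eqI[of _ _ k']) auto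
    ultimately show ?thesis using uv(3) unfolding toll_transit_def by auto
  qed
  moreover have "toll_transit (wheel L L) u v \<subseteq> {..L}"
    using uv(3) by (auto simp: toll_transit_def toll_walk_def vwalk_def)
  ultimately show ?thesis by auto
qed

lemma W_structure_one_rim:
  assumes "L > 1"
  shows "W_structure {..L} (saturated (wheel L L))"
proof -
  interpret W: pair_graph "wheel L L" using assms by (rule pair_graph_wheel)
  have "x \<in> toll_transit (wheel L L) u v \<longleftrightarrow>
      (u = v \<longrightarrow> x = u) \<and> ((u, v) \<in> parcs (wheel L L) \<longrightarrow> x \<in> {u, v})"
    if "u \<le> L" "x \<le> L" "v \<le> L" for u x v
  proof -
    consider "u = v" | "u \<noteq> v" "(u, v) \<in> parcs (wheel L L)" | "u \<noteq> v" "(u, v) \<notin> parcs (wheel L L)"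
      by blast
    then show ?thesis
    proof cases
      case 1
      then show ?thesis using W.parcs_irrefl by (simp add: toll_transit_def)
    next
      case 2
      then show ?thesis using W.toll_transit_adjacent by simp
    next
      case 3
      then show ?thesis using toll_transit_wheel_nonadjacent[OF assms] that by simp
    qed
  qed
  then have "saturated (wheel L L) = W_structure_of (wheel L L)"
    by (auto simp: saturated_def W_structure_of_def)
  then show ?thesis using W.W_structure_saturated_iff assms by simp
qed

text \<open>A toll walk from \<open>0\<close> through its rim neighbour \<open>1\<close> avoids the hub, hence never reaches the
  other rim.\<close>

lemma not_W_structure_two_rims:
  assumes "m > 1"
  shows "\<not> W_structure {..2 * m} (saturated (wheel (2 * m) m))"
proof
  let ?G = "wheel (2 * m) m"
  interpret W: pair_graph ?G using assms by (rule pair_graph_wheel)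
  assume "W_structure {..2 * m} (saturated ?G)"
  then have eq: "saturated ?G = W_structure_of ?G"
    using W.W_structure_saturated_iff assms by simp
  have side: "y div m = x div m" if "(x, y) \<in> parcs ?G" "x < 2 * m" "y < 2 * m" for x y
    using that assms by (auto simp: wheel_rim_arc spin_div)
  \<comment> \<open>The vertices \<open>0\<close> and \<open>m\<close> lie on different rims, so
    saturation puts every vertex between them, in particular the rim neighbour \<open>1\<close> of
    \<open>0\<close>.\<close>
  have "(0, m) \<notin> parcs ?G" using side[of 0 m] assms by auto
  then have "(0, 1, m) \<in> saturated ?G" using assms by (auto simp: saturated_def)
  then have "1 \<in> toll_transit ?G 0 m" using eq by (simp add: W_structure_of_def)
  then obtain w where w: "toll_walk ?G w" "hd w = 0" "last w = m" "1 \<in> set w"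
    using assms by (auto simp: toll_transit_def)
  then have "w \<noteq> []" by auto
  have "(0, 1) \<in> parcs ?G" using assms by (auto simp: wheel_rim_arc spin_def)
  moreover have "(0, 2 * m) \<in> parcs ?G" using assms by (simp add: wheel_spoke_arc)
  moreover have "x = w ! 1" if "x \<in> set w" "(0, x) \<in> parcs ?G" for x
  proof -
    have "x \<in> {x \<in> set w. (hd w, x) \<in> parcs ?G}" using that w(2) by simp
    then show ?thesis using w(1) unfolding toll_walk_def by (metis singletonD)
  qed
  \<comment> \<open>Both \<open>1\<close> and the hub are neighbours of \<open>0\<close>, and the
    toll condition at \<open>0\<close> admits only one neighbour on the walk.\<close>
  ultimately have "2 * m \<in> set w \<Longrightarrow> 2 * m = 1" using w(4) by metis
  then have hub: "2 * m \<notin> set w" using assms by (cases "2 * m \<in> set w") auto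
  have walk: "vwalk w (with_proj ?G)" using w by (simp add: toll_walk_def)
  have "set w \<subseteq> {x. x < 2 * m \<and> x div m = 0}"
  proof (rule vwalk_closed_set[OF walk])
    show "hd w \<in> {x. x < 2 * m \<and> x div m = 0}" using w assms by simp
    show "y \<in> {x. x < 2 * m \<and> x div m = 0}"
      if "x \<in> {x. x < 2 * m \<and> x div m = 0}" "y \<in> set w" "(x, y) \<in> parcs ?G" for x y
    proof -
      have "y \<le> 2 * m" "y \<noteq> 2 * m" using that walk hub by (auto simp: vwalk_def)
      then show ?thesis using that side[of x y] by auto
    qed
  qed
  moreover have "m \<in> set w" using w(3) \<open>w \<noteq> []\<close> last_in_set by metis
  ultimately show False using assms by auto
qed


section \<open>The Ehrenfeucht-Fraisse game on wheels\<close>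

primrec quantifier_rank :: "fo_formula \<Rightarrow> nat" where
  "quantifier_rank (FO_Eq i j) = 0"
| "quantifier_rank (FO_D i j k) = 0"
| "quantifier_rank (FO_Neg \<phi>) = quantifier_rank \<phi>"
| "quantifier_rank (FO_And \<phi> \<psi>) = max (quantifier_rank \<phi>) (quantifier_rank \<psi>)"
| "quantifier_rank (FO_Ex i \<phi>) = Suc (quantifier_rank \<phi>)"

text \<open>The winning positions of the duplicator with \<open>r\<close> rounds left, the pebbles being indexed by \<open>S\<close>:
  rotations by at most \<open>2 ^ r\<close> cannot tell the two positions apart.\<close>

definition matched ::
  "nat \<Rightarrow> nat \<Rightarrow> nat \<Rightarrow> nat \<Rightarrow> nat set \<Rightarrow> (nat \<Rightarrow> nat) \<Rightarrow> (nat \<Rightarrow> nat) \<Rightarrow> bool" where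
  "matched L m m' r S e e' \<longleftrightarrow>
     (\<forall>i\<in>S. e i \<le> L \<and> e' i \<le> L \<and> (e i = L \<longleftrightarrow> e' i = L)) \<and>
     (\<forall>i\<in>S. \<forall>j\<in>S. e i < L \<longrightarrow> e j < L \<longrightarrow>
        (\<forall>d. \<bar>d\<bar> \<le> 2 ^ r \<longrightarrow> (spin m d (e i) = e j \<longleftrightarrow> spin m' d (e' i) = e' j)))"

section \<open>Positions and replies of the duplicator\<close>

lemma matched_sym: "matched L m m' r S e e' \<Longrightarrow> matched L m' m r S e' e"
  unfolding matched_def by (metis le_neq_implies_less less_irrefl)

lemma matched_spin:
  assumes "matched L m m' r S e e'" "i \<in> S" "j \<in> S" "e i < L" "e j < L" "\<bar>d\<bar> \<le> 2 ^ r"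
  shows "spin m d (e i) = e j \<longleftrightarrow> spin m' d (e' i) = e' j"
  using assms unfolding matched_def by blast

lemma matched_eq:
  assumes "matched L m m' r S e e'" "i \<in> S" "j \<in> S"
  shows "e i = e j \<longleftrightarrow> e' i = e' j"
proof (cases "e i < L \<and> e j < L")
  case True
  then show ?thesis using matched_spin[OF assms, of 0] by (simp add: spin_0)
next
  case False
  then show ?thesis using assms unfolding matched_def by (metis le_neq_implies_less)
qed

text \<open>Rim adjacency is rotation by 1 or -1, within the radius \<open>2 ^ r\<close> even when
  no rounds are left; arcs at the hub are settled by the hub clause.\<close>

lemma matched_arc:
  assumes "matched L m m' r S e e'" "i \<in> S" "j \<in> S"
  shows "(e i, e j) \<in> parcs (wheel L m) \<longleftrightarrow> (e' i, e' j) \<in> parcs (wheel L m')"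
proof -
  have e: "e i \<le> L" "e' i \<le> L" "e i = L \<longleftrightarrow> e' i = L" "e j \<le> L" "e' j \<le> L" "e j = L \<longleftrightarrow> e' j = L"
    using assms unfolding matched_def by blast+
  show ?thesis
  proof (cases "e i < L \<and> e j < L")
    case True
    then have "e' i < L" "e' j < L" using e by auto
    then show ?thesis
      using True matched_spin[OF assms, of 1] matched_spin[OF assms, of "-1"]
      by (simp add: wheel_rim_arc)
  next
    case False
    then show ?thesis using e by (auto simp: wheel_def)
  qed
qed

text \<open>One round halves the radius. A vertex near an old pebble is answered by the same
  rotation of its partner, and one far from all pebbles by a vertex far from all partners, which
  exists by the bound on \<open>L\<close>; the hub answers the hub.\<close>

lemma matched_insert:
  assumes "finite S" and old: "matched L m m' (Suc r) S e e'"
    and "m dvd L" "m' dvd L" and m: "m > 2 ^ r" "m' > 2 ^ r"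
    and L: "card S * (2 * 2 ^ r + 1) < L" and a: "a \<le> L"
  obtains b where "b \<le> L" "matched L m m' r (insert i S) (e(i := a)) (e'(i := b))"
proof -
  define R :: int where "R = 2 ^ r"
  \<comment> \<open>The variable \<open>i\<close> may already carry a pebble, which is lifted before
    being placed again.\<close>
  define T where "T = S - {i}"
  have pos: "m > 0" "m' > 0" using m by auto
  have T: "T \<subseteq> S" "i \<notin> T" "insert i S = insert i T" "finite T"
    using \<open>finite S\<close> by (auto simp: T_def)
  have hub: "e j \<le> L" "e' j \<le> L" "e j = L \<longleftrightarrow> e' j = L" if "j \<in> T" for j
    using that T old unfolding matched_def by auto
  have far: "spin m d (e j) = e k \<longleftrightarrow> spin m' d (e' j) = e' k"
    if "j \<in> T" "k \<in> T" "e j < L" "e k < L" "\<bar>d\<bar> \<le> 2 * R" for j k d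
    using that T matched_spin[OF old, of j k d] by (auto simp: R_def)
  \<comment> \<open>Compares pebble \<open>i\<close> with itself: \<open>R\<close> is below both rim
    lengths, so a rotation by at most \<open>R\<close> fixes a vertex only if
    \<open>d = 0\<close>.\<close>
  have self: "spin m d x = x \<longleftrightarrow> spin m' d y = y" if "\<bar>d\<bar> \<le> R" for d x y
  proof -
    have "int m > R" "int m' > R" using m by (auto simp: R_def)
    then have "int m dvd d \<longleftrightarrow> d = 0" "int m' dvd d \<longleftrightarrow> d = 0"
      using that dvd_imp_le_int[of d "int m"] dvd_imp_le_int[of d "int m'"] by auto
    then show ?thesis using pos by (simp add: spin_eq_self_iff)
  qed
  have extend: "matched L m m' r (insert i S) (e(i := a)) (e'(i := b))"
    if b: "b \<le> L" "a = L \<longleftrightarrow> b = L"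
      and new: "\<And>j d. j \<in> T \<Longrightarrow> e j < L \<Longrightarrow> a < L \<Longrightarrow> \<bar>d\<bar> \<le> R \<Longrightarrow>
        spin m d (e j) = a \<longleftrightarrow> spin m' d (e' j) = b" for b
  proof -
    have inward: "spin m d a = e j \<longleftrightarrow> spin m' d b = e' j"
      if "j \<in> T" "e j < L" "a < L" "\<bar>d\<bar> \<le> R" for j d
    proof -
      have "spin m d a = e j \<longleftrightarrow> spin m (- d) (e j) = a" "spin m' d b = e' j \<longleftrightarrow> spin m' (- d) (e' j) = b"
        using spin_eq_spin_iff[of m 0 "e j" d a] spin_eq_spin_iff[of m' 0 "e' j" d b] pos
        by (auto simp: spin_0)
      then show ?thesis using new[of j "- d"] that by simp
    qed
    have "R \<ge> 0" by (simp add: R_def)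
    then have far': "spin m d (e j) = e k \<longleftrightarrow> spin m' d (e' j) = e' k"
      if "j \<in> T" "k \<in> T" "e j < L" "e k < L" "\<bar>d\<bar> \<le> R" for j k d
      using far that by simp
    show ?thesis
      unfolding matched_def T(3) R_def[symmetric]
      using T(2) a b hub new inward self far' by (auto simp: fun_upd_def)
  qed
  consider "a = L" | j d where "a < L" "j \<in> T" "e j < L" "\<bar>d\<bar> \<le> R" "a = spin m d (e j)"
    | "a < L" "\<And>j d. j \<in> T \<Longrightarrow> e j < L \<Longrightarrow> \<bar>d\<bar> \<le> R \<Longrightarrow> a \<noteq> spin m d (e j)"
    using a le_neq_implies_less by blast
  then show thesis
  proof cases
    case 1
    then show thesis using that[of L] extend[of L] by auto
  next
    case (2 j d)
    have "e' j < L" using hub[of j] 2 by auto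
    then have b: "spin m' d (e' j) < L" using \<open>m' dvd L\<close> by (simp add: spin_less)
    \<comment> \<open>The rotations combine to \<open>c - d\<close>, of size at most
      \<open>2 * R\<close>, which is exactly the radius of the old position.\<close>
    have "spin m c (e k) = a \<longleftrightarrow> spin m' c (e' k) = spin m' d (e' j)"
      if "k \<in> T" "e k < L" "\<bar>c\<bar> \<le> R" for k c
      using far[of k j "c - d"] that 2 pos by (simp add: spin_eq_spin_iff)
    then show thesis using b 2 that[of "spin m' d (e' j)"] extend[of "spin m' d (e' j)"] by auto
  next
    case 3
    \<comment> \<open>\<open>N\<close> collects everything within \<open>R\<close> of an old
      partner, at most \<open>2 * 2 ^ r + 1\<close> vertices per pebble. For \<open>b\<close>
      outside \<open>N\<close> both sides of the required equivalence are false.\<close>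
    define N where "N = (\<Union>j\<in>T. (\<lambda>d. spin m' d (e' j)) ` {- R..R})"
    have "card N \<le> (\<Sum>j\<in>T. card ((\<lambda>d. spin m' d (e' j)) ` {- R..R}))"
      unfolding N_def using T by (intro card_UN_le)
    also have "\<dots> \<le> (\<Sum>j\<in>T. 2 * 2 ^ r + 1)"
    proof (rule sum_mono)
      fix j
      have "card ((\<lambda>d. spin m' d (e' j)) ` {- R..R}) \<le> card {- R..R}" by (rule card_image_le) simp
      also have "\<dots> = 2 * 2 ^ r + 1" by (simp add: R_def nat_add_distrib nat_mult_distrib nat_power_eq)
      finally show "card ((\<lambda>d. spin m' d (e' j)) ` {- R..R}) \<le> 2 * 2 ^ r + 1" .
    qed
    also have "\<dots> \<le> card S * (2 * 2 ^ r + 1)"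
      using mult_le_mono1[OF card_mono[OF \<open>finite S\<close> T(1)], of "2 * 2 ^ r + 1"] by simp
    finally have "card N < card {..<L}" using L by simp
    moreover have "finite N" using T by (simp add: N_def)
    ultimately obtain b where b: "b < L" "b \<notin> N"
      by (metis card_mono leD lessThan_iff subsetI)
    then have "spin m' d (e' j) \<noteq> b" if "j \<in> T" "\<bar>d\<bar> \<le> R" for j d
      using that by (auto simp: N_def abs_le_iff)
    then show thesis using b 3 that[of b] extend[of b] by fastforce
  qed
qed

text \<open>A quantifier costs one round and adds at most one pebble, so
  \<open>card S + r \<le> n\<close> persists and one size requirement in terms of \<open>n\<close>
  serves the whole induction.\<close>

lemma fo_sat_wheel_iff:
  assumes "m dvd L" "m' dvd L" "m > 2 ^ n" "m' > 2 ^ n" "n * (2 * 2 ^ n + 1) < L"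
    and "finite S" "fo_free_vars \<phi> \<subseteq> S" "quantifier_rank \<phi> \<le> r" "card S + r \<le> n"
    and "matched L m m' r S e e'"
  shows "fo_sat {..L} (saturated (wheel L m)) e \<phi> \<longleftrightarrow> fo_sat {..L} (saturated (wheel L m')) e' \<phi>"
  using assms(6-)
proof (induction \<phi> arbitrary: S r e e')
  case (FO_Eq i j)
  then show ?case using matched_eq[of L m m' r S e e' i j] by simp
next
  case (FO_D i j k)
  have in_univ: "e l \<le> L" "e' l \<le> L" if "l \<in> S" for l
    using that FO_D.prems(5) unfolding matched_def by blast+
  \<comment> \<open>Membership in the saturated structure depends only on equalities and arcs among
    the three vertices.\<close>
  show ?case
    using FO_D.prems(2) in_univ matched_eq[OF FO_D.prems(5)] matched_arc[OF FO_D.prems(5)]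
    by (simp add: saturated_def)
next
  case (FO_Neg \<phi>)
  then show ?case by simp
next
  case (FO_And \<phi> \<psi>)
  then show ?case by (simp add: FO_And.IH[of S r e e'])
next
  case (FO_Ex i \<phi>)
  obtain q where q: "r = Suc q" "quantifier_rank \<phi> \<le> q"
    using FO_Ex.prems(3) by (cases r) auto
  have "card (insert i S) + q \<le> n"
    using FO_Ex.prems(1,4) q by (simp add: card_insert_if)
  then have step: "fo_sat {..L} (saturated (wheel L m)) (e(i := a)) \<phi> \<longleftrightarrow>
      fo_sat {..L} (saturated (wheel L m')) (e'(i := b)) \<phi>"
    if "matched L m m' q (insert i S) (e(i := a)) (e'(i := b))" for a b
    using q(2) that
  proof (intro FO_Ex.IH[of _ q])
    show "finite (insert i S)" "fo_free_vars \<phi> \<subseteq> insert i S"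
      using FO_Ex.prems(1,2) by auto
  qed
  have "q \<le> n" using q FO_Ex.prems(4) by simp
  then have pow: "(2::nat) ^ q \<le> 2 ^ n" by simp
  then have mq: "m > 2 ^ q" "m' > 2 ^ q" using assms(3,4) by (meson le_less_trans)+
  have "card S * (2 * 2 ^ q + 1) \<le> n * (2 * 2 ^ n + 1)"
    using FO_Ex.prems(4) pow by (intro mult_le_mono) linarith+
  then have Lq: "card S * (2 * 2 ^ q + 1) < L" using assms(5) by (rule le_less_trans)
  have old: "matched L m m' (Suc q) S e e'" using FO_Ex.prems(5) q by simp
  have "\<exists>b\<le>L. matched L m m' q (insert i S) (e(i := a)) (e'(i := b))" if "a \<le> L" for a
    using matched_insert[OF FO_Ex.prems(1) old assms(1,2) mq Lq that] by metis
  \<comment> \<open>The back move is the forth move with the two wheels exchanged.\<close>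
  moreover have "\<exists>a\<le>L. matched L m m' q (insert i S) (e(i := a)) (e'(i := b))" if "b \<le> L" for b
    using matched_insert[OF FO_Ex.prems(1) matched_sym[OF old] assms(2,1) mq(2,1) Lq that]
      matched_sym by metis
  ultimately show ?case using step by (simp add: Bex_def) metis
qed

lemma fo_models_wheel_iff:
  assumes "fo_sentence \<sigma>" "m dvd L" "m' dvd L"
    and "m > 2 ^ quantifier_rank \<sigma>" "m' > 2 ^ quantifier_rank \<sigma>"
    and "quantifier_rank \<sigma> * (2 * 2 ^ quantifier_rank \<sigma> + 1) < L"
  shows "fo_models {..L} (saturated (wheel L m)) \<sigma> \<longleftrightarrow> fo_models {..L} (saturated (wheel L m')) \<sigma>"
proof -
  \<comment> \<open>With no pebble placed, \<open>matched\<close> holds vacuously, so the same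
    assignment can be used on both sides.\<close>
  have "fo_sat {..L} (saturated (wheel L m)) e \<sigma> \<longleftrightarrow> fo_sat {..L} (saturated (wheel L m')) e \<sigma>" for e
    using assms by (intro fo_sat_wheel_iff[where S = "{}" and r = "quantifier_rank \<sigma>"])
      (auto simp: fo_sentence_def matched_def)
  then show ?thesis by (simp add: fo_models_def)
qed

theorem theorem18:
  shows "\<not> (\<exists>\<sigma>. fo_sentence \<sigma> \<and>
             (\<forall>(X :: nat set) D. connected_structure X D \<longrightarrow>
                (W_structure X D \<longleftrightarrow> fo_models X D \<sigma>)))"
proof
  assume "\<exists>\<sigma>. fo_sentence \<sigma> \<and> (\<forall>(X :: nat set) D. connected_structure X D \<longrightarrow>
    (W_structure X D \<longleftrightarrow> fo_models X D \<sigma>))"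
  then obtain \<sigma> where \<sigma>: "fo_sentence \<sigma>"
    "\<And>(X :: nat set) D. connected_structure X D \<Longrightarrow> W_structure X D \<longleftrightarrow> fo_models X D \<sigma>" by blast
  define n where "n = quantifier_rank \<sigma>"
  \<comment> \<open>Both rim lengths, \<open>m\<close> and \<open>2 * m\<close>, must exceed
    \<open>2 ^ n\<close>, and the count of forbidden vertices must stay below
    \<open>L = 2 * m\<close>; the final \<open>+ 1\<close> also ensures
    \<open>m > 1\<close>.\<close>
  define m where "m = n * (2 * 2 ^ n + 1) + 2 ^ n + 1"
  have m: "m > 1" "m > 2 ^ n" "n * (2 * 2 ^ n + 1) < m" by (auto simp: m_def)
  have "fo_models {..2 * m} (saturated (wheel (2 * m) (2 * m))) \<sigma> \<longleftrightarrow>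
      fo_models {..2 * m} (saturated (wheel (2 * m) m)) \<sigma>"
    using \<sigma>(1) m by (intro fo_models_wheel_iff) (auto simp flip: n_def)
  moreover have "connected_structure {..2 * m} (saturated (wheel (2 * m) (2 * m)))"
    "connected_structure {..2 * m} (saturated (wheel (2 * m) m))"
    using m(1) by (auto intro!: connected_structure_wheel)
  ultimately have "W_structure {..2 * m} (saturated (wheel (2 * m) (2 * m))) \<longleftrightarrow>
      W_structure {..2 * m} (saturated (wheel (2 * m) m))"
    using \<sigma>(2) by simp
  then show False
    using W_structure_one_rim[of "2 * m"] not_W_structure_two_rims[of m] m(1) by simp
qed

end
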